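(* Let $A\in\mathbb{R}_+^{n\times n}$, $N=\{1,\dots,n\}$, and let $\lambda$ be a max-algebraic eigenvalue of $A$. Then $V(A,\lambda)$ contains a simple image eigenvector, i.e. a nonzero vector $b\in V(A,\lambda)$ such that the system $A\otimes y=b$ has exactly one solution $y\in\mathbb{R}_+^n$, if and only if there exists a nonempty subset $N'\subseteq N$ with the following properties: (i) there exists $x\in V(A,\lambda)$ with $\operatorname{supp}(x)=N'$; and, for such an $x$, (ii) $\gamma_i^*(A,x)=0$ for all $i\notin N'$; (iii) $N'=N_c(A,x,\lambda)$; (iv) all (strongly connected) components of $\mathcal{G}_c(A,x,\lambda)=\mathcal{G}_c(A,\lambda)|_{N'}$ are cycles.
   Context: Max algebra: $\mathbb{R}_+$ is the set of nonnegative reals with $a\otimes b=ab$ and $a\oplus b=\max(a,b)$, extended to matrices and vectors in the usual way, so $(A\otimes x)_i=\max_j a_{ij}x_j$. $V(A,\lambda)=\{x\in\mathbb{R}_+^n: A\otimes x=\lambda x\}$; its nonzero elements are the eigenvectors associated with $\lambda$, and $\lambda\ge 0$ is an eigenvalue if such a vector exists. $\operatorname{supp}(x)=\{i:x_i>0\}$. For $b\in\mathbb{R}_+^n$, $\gamma_j^*(A,b)=\max\{\alpha\in\mathbb{R}_+\cup\{+\infty\}:\alpha A_{\cdot j}\le b\}=\min_{i: a_{ij}\ne0} b_i a_{ij}^{-1}$, where $A_{\cdot j}$ is the $j$-th column, $0\cdot(+\infty)=0$, and the value is $+\infty$ if $A_{\cdot j}=0$. $\mathcal{G}(A)$ is the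 digraph with node set $N$, with an edge $(i,j)$ of weight $a_{ij}$ iff $a_{ij}>0$. The geometric mean of a cycle $(i_1,\dots,i_k,i_1)$ (elementary closed path, loops allowed) is $\sqrt[k]{a_{i_1i_2}\cdots a_{i_ki_1}}$. For $x\in V(A,\lambda)$, $\mathcal{G}_c(A,x,\lambda)$ is the subgraph of $\mathcal{G}(A)$ consisting of all nodes and edges belonging to cycles of $\mathcal{G}(A)$ with all nodes in $\operatorname{supp}(x)$ and geometric mean equal to $\lambda$; its node set is $N_c(A,x,\lambda)$. $\mathcal{G}_c(A,\lambda)=\mathcal{G}_c(A,x',\lambda)$, where $x'\in V(A,\lambda)$ has support containing the supports of all $x\in V(A,\lambda)$. $\mathcal{G}_c(A,\lambda)|_{N'}$ is the subgraph induced on its nodes lying in $N'$. A component "is a cycle" if its nodes and edges are exactly those of one elementary cycle (a loop counts as a cycle of length 1). The conditions (ii)-(iv) depend on $x$ only through $\operatorname{supp}(x)=N'$. *)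

theory Defs
  imports "HOL-Analysis.Analysis" "Graph_Theory.Digraph_Component"
begin

text \<open>
  The index set \<open>N = {1, \<dots>, n}\<close> is the universe of a finite type \<open>'n\<close>. Vectors and
  matrices have real entries; nonnegativity is stated explicitly.
\<close>

definition nonneg_vec :: "real ^ 'n \<Rightarrow> bool"
  where "nonneg_vec x \<longleftrightarrow> (\<forall>i. 0 \<le> x $ i)"

definition nonneg_mat :: "real ^ 'n ^ 'm \<Rightarrow> bool"
  where "nonneg_mat A \<longleftrightarrow> (\<forall>i j. 0 \<le> A $ i $ j)"

definition maxmult :: "real ^ 'n ^ 'm \<Rightarrow> real ^ 'n \<Rightarrow> real ^ 'm"  (infixr \<open>\<otimes>\<^sub>m\<close> 75)
  where "A \<otimes>\<^sub>m x = (\<chi> i. Max (range (\<lambda>j. A $ i $ j * x $ j)))"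

definition V :: "real ^ 'n ^ 'n \<Rightarrow> real \<Rightarrow> (real ^ 'n) set"
  where "V A lam = {x. nonneg_vec x \<and> A \<otimes>\<^sub>m x = lam *\<^sub>R x}"

definition max_eigenvalue :: "real ^ 'n ^ 'n \<Rightarrow> real \<Rightarrow> bool"
  where "max_eigenvalue A lam \<longleftrightarrow> 0 \<le> lam \<and> (\<exists>x\<in>V A lam. x \<noteq> 0)"

definition supp :: "real ^ 'n \<Rightarrow> 'n set"
  where "supp x = {i. 0 < x $ i}"

definition simple_image_eigenvector :: "real ^ 'n ^ 'n \<Rightarrow> real \<Rightarrow> real ^ 'n \<Rightarrow> bool"
  where "simple_image_eigenvector A lam b \<longleftrightarrow>
    b \<in> V A lam \<and> b \<noteq> 0 \<and> (\<exists>!y. nonneg_vec y \<and> A \<otimes>\<^sub>m y = b)"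

text \<open>
  \<open>\<gamma>\<^sup>*\<^sub>j(A, b)\<close>, with values in \<open>[0, \<infinity>]\<close>; in \<^typ>\<open>ennreal\<close> one has \<open>0 * \<infinity> = 0\<close>.
  The supremum is a maximum by \<open>gamma_star_attained\<close>.
\<close>

definition gamma_star :: "real ^ 'n ^ 'm \<Rightarrow> real ^ 'm \<Rightarrow> 'n \<Rightarrow> ennreal"
  where "gamma_star A b j = Sup {\<alpha>. \<forall>i. \<alpha> * ennreal (A $ i $ j) \<le> ennreal (b $ i)}"

lemma gamma_star_attained:
  "gamma_star A b j * ennreal (A $ i $ j) \<le> ennreal (b $ i)"
proof -
  let ?S = "{\<alpha>. \<forall>i. \<alpha> * ennreal (A $ i $ j) \<le> ennreal (b $ i)}"
  have "0 \<in> ?S" by simp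
  then have "Sup ?S * ennreal (A $ i $ j) = (SUP \<alpha>\<in>?S. \<alpha> * ennreal (A $ i $ j))"
    using SUP_mult_right_ennreal[where f = "\<lambda>\<alpha>. \<alpha>" and I = ?S] by simp
  also have "\<dots> \<le> ennreal (b $ i)" by (rule SUP_least) simp
  finally show ?thesis by (simp add: gamma_star_def)
qed

definition matrix_digraph :: "real ^ 'n ^ 'n \<Rightarrow> ('n, 'n \<times> 'n) pre_digraph"
  where "matrix_digraph A =
    \<lparr> verts = UNIV, arcs = {(i, j). 0 < A $ i $ j}, tail = fst, head = snd \<rparr>"

text \<open>
  Cycles are lists of arcs; \<^const>\<open>pre_digraph.cycle\<close> describes elementary cycles, loops
  included, and the nodes of a cycle are the tails of its arcs.
\<close>

definition cycle_mean :: "real ^ 'n ^ 'n \<Rightarrow> ('n \<times> 'n) list \<Rightarrow> real"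
  where "cycle_mean A p = root (length p) (\<Prod>e\<leftarrow>p. A $ fst e $ snd e)"

definition critical_cycle ::
  "real ^ 'n ^ 'n \<Rightarrow> real ^ 'n \<Rightarrow> real \<Rightarrow> ('n \<times> 'n) list \<Rightarrow> bool"
  where "critical_cycle A x lam p \<longleftrightarrow>
    pre_digraph.cycle (matrix_digraph A) p \<and> fst ` set p \<subseteq> supp x \<and> cycle_mean A p = lam"

definition Gc :: "real ^ 'n ^ 'n \<Rightarrow> real ^ 'n \<Rightarrow> real \<Rightarrow> ('n, 'n \<times> 'n) pre_digraph"
  where "Gc A x lam =
    \<lparr> verts = (\<Union>p\<in>{p. critical_cycle A x lam p}. fst ` set p),
      arcs = (\<Union>p\<in>{p. critical_cycle A x lam p}. set p),
      tail = fst, head = snd \<rparr>"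

definition Nc :: "real ^ 'n ^ 'n \<Rightarrow> real ^ 'n \<Rightarrow> real \<Rightarrow> 'n set"
  where "Nc A x lam = verts (Gc A x lam)"

definition max_support :: "real ^ 'n ^ 'n \<Rightarrow> real \<Rightarrow> real ^ 'n \<Rightarrow> bool"
  where "max_support A lam x' \<longleftrightarrow> x' \<in> V A lam \<and> (\<forall>x\<in>V A lam. supp x \<subseteq> supp x')"

text \<open>
  The choice of \<open>x'\<close> is immaterial, see \<open>Gc_full_eq\<close>.
\<close>

definition Gc_full :: "real ^ 'n ^ 'n \<Rightarrow> real \<Rightarrow> ('n, 'n \<times> 'n) pre_digraph"
  where "Gc_full A lam = Gc A (SOME x'. max_support A lam x') lam"

text \<open>
  \<^const>\<open>induce_subgraph\<close> does not intersect the given node set with the nodes of the graph.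
\<close>

definition restrict_nodes :: "('a, 'b) pre_digraph \<Rightarrow> 'a set \<Rightarrow> ('a, 'b) pre_digraph"
  where "restrict_nodes G M = induce_subgraph G (verts G \<inter> M)"

definition is_cycle_graph :: "('a, 'b) pre_digraph \<Rightarrow> bool"
  where "is_cycle_graph H \<longleftrightarrow>
    (\<exists>p. pre_digraph.cycle H p \<and> verts H = tail H ` set p \<and> arcs H = set p)"

lemma V_sup_closed:
  fixes x y :: "real ^ 'n"
  assumes A: "nonneg_mat A" and "0 \<le> lam" and x: "x \<in> V A lam" and y: "y \<in> V A lam"
  shows "(\<chi> i. max (x $ i) (y $ i)) \<in> V A lam"
proof -
  let ?z = "\<chi> i. max (x $ i) (y $ i)"
  have *: "(A \<otimes>\<^sub>m ?z) $ i = max ((A \<otimes>\<^sub>m x) $ i) ((A \<otimes>\<^sub>m y) $ i)" for i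
  proof -
    have "A $ i $ j * max (x $ j) (y $ j) = max (A $ i $ j * x $ j) (A $ i $ j * y $ j)" for j
      using A by (simp add: nonneg_mat_def max_mult_distrib_left)
    moreover have "Max (range (\<lambda>j. max (f j) (g j))) = max (Max (range f)) (Max (range g))"
      for f g :: "'n \<Rightarrow> real"
    proof (rule Max_eqI)
      show "w \<le> max (Max (range f)) (Max (range g))"
        if "w \<in> range (\<lambda>j. max (f j) (g j))" for w
        using that by (fastforce intro: max.mono)
      have "Max (range f) \<in> range f" "Max (range g) \<in> range g" by (simp_all add: Max_in)
      then obtain a b where ab: "Max (range f) = f a" "Max (range g) = g b"
        by (auto simp only: image_iff)
      have "g a \<le> Max (range g)" "f b \<le> Max (range f)" by (simp_all)
      then have "max (f a) (g b) = max (f a) (g a) \<or> max (f a) (g b) = max (f b) (g b)"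
        using ab by (auto simp: max_def)
      then show "max (Max (range f)) (Max (range g)) \<in> range (\<lambda>j. max (f j) (g j))"
        using ab by auto
    qed simp
    ultimately show ?thesis by (simp add: maxmult_def)
  qed
  have "A \<otimes>\<^sub>m ?z = lam *\<^sub>R ?z"
    using x y \<open>0 \<le> lam\<close> by (simp add: vec_eq_iff * V_def max_mult_distrib_left)
  moreover have "nonneg_vec ?z" using x by (auto simp: V_def nonneg_vec_def le_max_iff_disj)
  ultimately show ?thesis by (simp add: V_def)
qed

lemma max_support_exists:
  fixes A :: "real ^ 'n ^ 'n"
  assumes "nonneg_mat A" and "max_eigenvalue A lam"
  shows "\<exists>x'. max_support A lam x'"
proof -
  obtain x0 where "x0 \<in> V A lam" using assms(2) by (auto simp: max_eigenvalue_def)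
  moreover have "\<forall>y. y \<in> V A lam \<longrightarrow> card (supp y) < Suc (CARD('n))"
    by (simp add: card_mono less_Suc_eq_le)
  ultimately obtain x where x: "x \<in> V A lam"
    and m: "\<And>y. y \<in> V A lam \<Longrightarrow> card (supp y) \<le> card (supp x)"
    using ex_has_greatest_nat[of "\<lambda>y. y \<in> V A lam" x0 "\<lambda>y. card (supp y)"] by (metis)
  have "supp y \<subseteq> supp x" if y: "y \<in> V A lam" for y
  proof -
    let ?z = "\<chi> i. max (x $ i) (y $ i)"
    have "?z \<in> V A lam" using V_sup_closed assms x y by (auto simp: max_eigenvalue_def)
    moreover have z: "supp ?z = supp x \<union> supp y" by (auto simp: supp_def)
    ultimately have "card (supp x \<union> supp y) \<le> card (supp x)" using m by metis
    then have "supp x = supp x \<union> supp y" by (intro card_seteq) simp_all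
    then show ?thesis by blast
  qed
  then show ?thesis using x by (auto simp: max_support_def)
qed

lemma Gc_full_eq:
  assumes "max_support A lam x'"
  shows "Gc_full A lam = Gc A x' lam"
proof -
  have "max_support A lam (SOME x'. max_support A lam x')" using assms by (rule someI)
  then have "supp (SOME x'. max_support A lam x') = supp x'"
    using assms unfolding max_support_def by blast
  then show ?thesis by (simp add: Gc_full_def Gc_def critical_cycle_def)
qed

end

theory Submission
  imports Defs
begin

text \<open>
  For \<open>\<lambda> > 0\<close> and \<open>x \<in> V(A, \<lambda>)\<close> call \<open>(i, j)\<close> tight if \<open>a\<^sub>i\<^sub>j x\<^sub>j = \<lambda> x\<^sub>i > 0\<close>. Since
  \<open>a\<^sub>i\<^sub>j x\<^sub>j \<le> \<lambda> x\<^sub>i\<close>, multiplying along a cycle shows that the critical cycles are exactly the cycles of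
  tight arcs. The system \<open>A \<otimes> y = b\<close> with \<open>b \<in> V(A, \<lambda>)\<close> has the solution \<open>b / \<lambda>\<close>; it is the only one
  iff \<open>\<gamma>\<^sup>*\<^sub>i = 0\<close> outside \<open>supp b\<close> and the tight arcs of \<open>b\<close> form the graph of a permutation of \<open>supp b\<close>,
  because otherwise some entry of \<open>b / \<lambda>\<close> can be changed. A permutation graph is a disjoint union of
  cycles, which gives (iii) and (iv). Conversely, rescaling \<open>x\<close> by suitable positive factors removes
  all tight arcs that lie on no cycle, and by (iii) and (iv) the remaining ones form a permutation.
  For \<open>\<lambda> = 0\<close> both sides fail: there are no critical cycles, and a column \<open>j\<close> with \<open>b\<^sub>j > 0\<close> vanishes,
  so that \<open>y\<^sub>j\<close> is free.
\<close>

section \<open>Cycles and strongly connected components in digraphs\<close>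

context wf_digraph
begin

lemma cycle_imp_arcs: "cycle p \<Longrightarrow> set p \<subseteq> arcs G"
  by (auto simp: cycle_def awalk_def)

lemma closed_awalk_ends:
  assumes "awalk u p u" and "p \<noteq> []"
  shows "tail G (hd p) = u" and "head G (last p) = u"
proof -
  have "awhd u p = u" "awlast u p = u" using assms(1) by auto
  then show "tail G (hd p) = u" "head G (last p) = u"
    using assms(2) by (simp_all add: awalk_verts_conv hd_append hd_map)
qed

text \<open>\<open>cycle\<close> only asks that the node sequence without its first entry be
  distinct. A closed walk ends where it starts, so this is the list of tails rotated by one
  place.\<close>

lemma cycle_distinct_tails:
  assumes "cycle p"
  shows "distinct (map (tail G) p)"
proof -
  obtain u where u: "awalk u p u" and d: "distinct (tl (awalk_verts u p))" and "p \<noteq> []"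
    using assms by (auto simp: cycle_def)
  have "awalk_verts u p = map (tail G) p @ [head G (last p)]"
    using \<open>p \<noteq> []\<close> by (simp add: awalk_verts_conv)
  moreover have "head G (last p) = tail G (hd p)"
    using closed_awalk_ends[OF u \<open>p \<noteq> []\<close>] by simp
  ultimately show ?thesis using d \<open>p \<noteq> []\<close> by (cases p) auto
qed

text \<open>Tails and heads are the node sequence without its last and first entry respectively, and
  these two entries coincide.\<close>

lemma cycle_heads_eq_tails:
  assumes "cycle p"
  shows "head G ` set p = tail G ` set p"
proof -
  obtain u where u: "awalk u p u" and "p \<noteq> []"
    using assms by (auto simp: cycle_def)
  have c: "cas u p u" using u by (simp add: awalk_def)
  have "head G (last p) = tail G (hd p)" "u = tail G (hd p)"
    using closed_awalk_ends[OF u \<open>p \<noteq> []\<close>] by simp_all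
  then have "head G (last p) \<in> tail G ` set p" "tail G (hd p) \<in> head G ` set p"
    using \<open>p \<noteq> []\<close> by (metis hd_in_set last_in_set imageI)+
  moreover have "set (map (tail G) p @ [head G (last p)]) = set (tail G (hd p) # map (head G) p)"
    using awalk_verts_conv awalk_verts_conv'[OF c] \<open>p \<noteq> []\<close> by metis
  ultimately show ?thesis by (simp add: insert_absorb)
qed

text \<open>Every node of the closed walk reaches the base node \<open>u\<close> and is reached from
  it.\<close>

lemma cycle_arc_reachable:
  assumes "cycle p" and "e \<in> set p" and "f \<in> set p"
  shows "tail G e \<rightarrow>\<^sup>* tail G f"
proof -
  obtain u where u: "awalk u p u" and "p \<noteq> []"
    using assms by (auto simp: cycle_def)
  have "tail G e \<in> set (awalk_verts u p)" "tail G f \<in> set (awalk_verts u p)"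
    using assms by (auto simp: awalk_verts_conv)
  then have "u \<rightarrow>\<^sup>* tail G f" "tail G e \<rightarrow>\<^sup>* u"
    using u awalk_verts_reachable_from awalk_verts_reachable_to by blast+
  then show ?thesis using reachable_trans by blast
qed

lemma cycle_head_reaches_tail:
  assumes "cycle p" and "e \<in> set p"
  shows "head G e \<rightarrow>\<^sup>* tail G e"
proof -
  have "head G e \<in> tail G ` set p" using cycle_heads_eq_tails assms by blast
  then show ?thesis using cycle_arc_reachable assms by auto
qed

text \<open>The way back can be shortened to an elementary path \<open>q\<close>. Prepending
  \<open>e\<close> only adds a first node, which the distinctness condition in \<open>cycle\<close>
  ignores; for a loop \<open>q\<close> may be empty.\<close>

lemma cycle_through_arc:
  assumes "e \<in> arcs G" and "head G e \<rightarrow>\<^sup>* tail G e"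
  obtains p where "cycle p" and "e \<in> set p"
proof -
  obtain q where q: "apath (head G e) q (tail G e)"
    using assms(2) reachable_apath by blast
  have "awalk (tail G e) (e # q) (tail G e)"
    using q assms(1) by (auto simp: apath_def awalk_Cons_iff)
  moreover have "distinct (tl (awalk_verts (tail G e) (e # q)))"
    using q by (simp add: apath_def)
  ultimately have "cycle (e # q)" unfolding cycle_def by blast
  then show thesis using that by auto
qed

text \<open>Moves cycles between the matrix digraph, the tight digraph and \<open>Gc\<close>, which
  share tails and heads but differ in their arcs.\<close>

lemma cycle_transfer:
  assumes "wf_digraph H" and "tail H = tail G" and "head H = head G"
    and "cycle p" and "set p \<subseteq> arcs H"
  shows "pre_digraph.cycle H p"
proof -
  obtain u where u: "awalk u p u" and d: "distinct (tl (awalk_verts u p))" and "p \<noteq> []"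
    using assms by (auto simp: cycle_def)
  have "compatible H G" using assms by (simp add: compatible_def)
  have "u = tail G (hd p)" using closed_awalk_ends[OF u \<open>p \<noteq> []\<close>] by simp
  moreover have "hd p \<in> arcs H" using \<open>p \<noteq> []\<close> assms(5) by auto
  ultimately have "u \<in> verts H" using wf_digraph.tail_in_verts[OF assms(1)] assms(2) by simp
  then have "pre_digraph.awalk H u p u"
    using u assms(5) compatible_cas[OF \<open>compatible H G\<close>]
    by (simp add: pre_digraph.awalk_def)
  then show ?thesis
    using d \<open>p \<noteq> []\<close> compatible_awalk_verts[OF \<open>compatible H G\<close>]
    by (auto simp: pre_digraph.cycle_def)
qed

text \<open>By \<open>cyc\<close>, each arc leaving a node stays inside the component of that node,
  and an elementary cycle has just one arc per tail.\<close>

lemma inj_on_tail_if_sccs_cycle: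
  assumes cyc: "\<And>e. e \<in> arcs G \<Longrightarrow> head G e \<rightarrow>\<^sup>* tail G e"
    and sccs: "\<forall>H\<in>sccs. is_cycle_graph H"
  shows "inj_on (tail G) (arcs G)"
proof (rule inj_onI)
  fix e f assume e: "e \<in> arcs G" and f: "f \<in> arcs G" and ef: "tail G e = tail G f"
  let ?u = "tail G e"
  let ?S = "scc_of ?u"
  have S: "?S \<in> sccs_verts"
    unfolding sccs_verts_def scc_of_def using tail_in_verts[OF e]
    by (auto intro: reachable_trans)
  then have "G \<restriction> ?S \<in> sccs" by (rule in_verts_sccsD_sccs)
  then obtain p where p: "pre_digraph.cycle (G \<restriction> ?S) p" "arcs (G \<restriction> ?S) = set p"
    using sccs by (auto simp: is_cycle_graph_def)
  have in_S: "a \<in> set p" if "a \<in> arcs G" "tail G a = ?u" for a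
  proof -
    have "?u \<rightarrow>\<^sup>* head G a" "head G a \<rightarrow>\<^sup>* ?u" "?u \<rightarrow>\<^sup>* ?u"
      using that cyc[of a] in_arcs_imp_in_arcs_ends[OF that(1)] reachable_adjI
        tail_in_verts[OF that(1)] by auto
    then have "a \<in> arcs (G \<restriction> ?S)" using that by (auto simp: scc_of_def)
    then show ?thesis by (simp only: p(2))
  qed
  have "wf_digraph (G \<restriction> ?S)" by (rule wellformed_induce_subgraph)
  then have "distinct (map (tail G) p)"
    using wf_digraph.cycle_distinct_tails p(1) by fastforce
  then show "e = f" using in_S e f ef by (auto simp: distinct_map dest: inj_onD)
qed

text \<open>By \<open>out\<close> and \<open>inj\<close> each node has exactly one outgoing arc, so
  every walk from \<open>u\<close> goes round a single cycle. Hence the nodes reachable from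
  \<open>u\<close> are those of this cycle, which fills the component.\<close>

lemma sccs_cycle_if_inj_on_tail:
  assumes cyc: "\<And>e. e \<in> arcs G \<Longrightarrow> head G e \<rightarrow>\<^sup>* tail G e"
    and out: "verts G \<subseteq> tail G ` arcs G"
    and inj: "inj_on (tail G) (arcs G)"
    and H: "H \<in> sccs"
  shows "is_cycle_graph H"
proof -
  obtain S where S: "S \<in> sccs_verts" "H = G \<restriction> S" using H by (auto simp: sccs_conv_sccs_verts)
  then obtain u where u: "u \<in> S" by (auto simp: sccs_verts_def)
  then have "u \<in> verts G" using S by (auto simp: sccs_verts_def dest: reachable_in_verts)
  then obtain e where e: "e \<in> arcs G" "tail G e = u" using out by blast
  then obtain p where p: "cycle p" "e \<in> set p" using cycle_through_arc cyc by blast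
  have sub: "tail G ` set p \<subseteq> S"
  proof
    fix v assume "v \<in> tail G ` set p"
    then have "u \<rightarrow>\<^sup>* v" "v \<rightarrow>\<^sup>* u" using cycle_arc_reachable p e by auto
    then show "v \<in> S" using S(1) u unfolding sccs_verts_def by blast
  qed
  \<comment> \<open>By injectivity \<open>p\<close> contains every arc that leaves one of its nodes,
    so no walk can leave the cycle.\<close>
  have arc_p: "f \<in> set p" if "f \<in> arcs G" "tail G f \<in> tail G ` set p" for f
    using that inj cycle_imp_arcs[OF p(1)] by (metis (no_types, lifting) imageE inj_onD subsetD)
  have "v \<in> tail G ` set p" if "u \<rightarrow>\<^sup>* v" for v
    using that
  proof (induction rule: reachable_induct)
    case base
    then show ?case using e p by auto
  next
    case (step v w)
    then obtain f where "f \<in> arcs G" "tail G f = v" "head G f = w" by (auto simp: arcs_ends_def arc_to_ends_def)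
    then show ?case using step arc_p cycle_heads_eq_tails[OF p(1)] by blast
  qed
  then have vS: "S = tail G ` set p" using sub S(1) u by (auto simp: sccs_verts_def)
  then have aS: "arcs H = set p"
    using S(2) arc_p cycle_imp_arcs[OF p(1)] cycle_heads_eq_tails[OF p(1)] by auto
  have "wf_digraph H" using S(2) wellformed_induce_subgraph by simp
  then have "pre_digraph.cycle H p" using cycle_transfer[of H p] S(2) p(1) aS by simp
  then show ?thesis using aS vS S(2) by (auto simp: is_cycle_graph_def)
qed

end

section \<open>Max-linear systems: changing one entry of a solution, and the vanishing of
  \<open>gamma_star\<close>\<close>

lemma maxmult_eq_iff:
  "A \<otimes>\<^sub>m x = b \<longleftrightarrow> (\<forall>i. (\<forall>j. A $ i $ j * x $ j \<le> b $ i) \<and> (\<exists>j. A $ i $ j * x $ j = b $ i))"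
proof -
  have "Max (range (\<lambda>j. A $ i $ j * x $ j)) = b $ i \<longleftrightarrow>
      (\<forall>j. A $ i $ j * x $ j \<le> b $ i) \<and> (\<exists>j. A $ i $ j * x $ j = b $ i)" for i
    by (subst Max_eq_iff) (auto simp: image_iff intro: sym)
  then show ?thesis by (simp add: maxmult_def vec_eq_iff)
qed

lemma V_iff:
  "x \<in> V A lam \<longleftrightarrow> (\<forall>i. 0 \<le> x $ i) \<and> (\<forall>i j. A $ i $ j * x $ j \<le> lam * x $ i) \<and>
     (\<forall>i. \<exists>j. A $ i $ j * x $ j = lam * x $ i)"
  unfolding V_def nonneg_vec_def mem_Collect_eq maxmult_eq_iff by auto

text \<open>Only rows whose maximum is attained in column \<open>j\<close> can lose it, and
  \<open>other\<close> provides a replacement for them.\<close>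

lemma maxmult_update:
  assumes y: "A \<otimes>\<^sub>m y = b"
    and le: "\<And>k. A $ k $ j * c \<le> b $ k"
    and other: "\<And>k. A $ k $ j * y $ j = b $ k \<Longrightarrow>
      A $ k $ j * c = b $ k \<or> (\<exists>l. l \<noteq> j \<and> A $ k $ l * y $ l = b $ k)"
  shows "A \<otimes>\<^sub>m (\<chi> i. if i = j then c else y $ i) = b"
  unfolding maxmult_eq_iff
proof (intro allI conjI)
  fix k l
  show "A $ k $ l * (\<chi> i. if i = j then c else y $ i) $ l \<le> b $ k"
    using y le by (auto simp: maxmult_eq_iff)
  obtain l where l: "A $ k $ l * y $ l = b $ k" using y by (auto simp: maxmult_eq_iff)
  show "\<exists>l. A $ k $ l * (\<chi> i. if i = j then c else y $ i) $ l = b $ k"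
  proof (cases "l = j")
    case True
    then show ?thesis using other[of k] l by fastforce
  next
    case False
    then show ?thesis using l by (intro exI[of _ l]) simp
  qed
qed

text \<open>The form in which uniqueness is exploited: an admissible change of a single entry cannot
  be a real change. It is applied with entries that are lowered to 0 or raised.\<close>

lemma simple_image_eigenvector_update:
  assumes "simple_image_eigenvector A lam b" and "nonneg_vec y" and "A \<otimes>\<^sub>m y = b" and "0 \<le> c"
    and "\<And>k. A $ k $ j * c \<le> b $ k"
    and "\<And>k. A $ k $ j * y $ j = b $ k \<Longrightarrow>
      A $ k $ j * c = b $ k \<or> (\<exists>l. l \<noteq> j \<and> A $ k $ l * y $ l = b $ k)"
  shows "y $ j = c"
proof -
  let ?z = "\<chi> i. if i = j then c else y $ i"
  have "A \<otimes>\<^sub>m ?z = b" using assms by (intro maxmult_update) auto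
  moreover have "nonneg_vec ?z" using assms by (simp add: nonneg_vec_def)
  ultimately have "?z = y" using assms by (auto simp: simple_image_eigenvector_def)
  then have "?z $ j = y $ j" by simp
  then show ?thesis by simp
qed

text \<open>If no positive entry of the column meets a zero of \<open>b\<close>, the finitely many
  quotients that bound the multiplier are all positive, and so is their minimum.\<close>

lemma gamma_star_eq_0_iff:
  fixes A :: "real ^ 'n ^ 'm"
  assumes "nonneg_mat A" and "nonneg_vec b"
  shows "gamma_star A b j = 0 \<longleftrightarrow> (\<exists>k. 0 < A $ k $ j \<and> b $ k = 0)"
    and "gamma_star A b j \<noteq> 0 \<Longrightarrow> \<exists>c>0. \<forall>k. A $ k $ j * c \<le> b $ k"
proof -
  have zero: "gamma_star A b j = 0" if "0 < A $ k $ j" "b $ k = 0" for k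
    using gamma_star_attained[of A b j k] that by (simp add: ennreal_eq_0_iff)
  have step: "\<exists>c>0. \<forall>k. A $ k $ j * c \<le> b $ k" if no: "\<nexists>k. 0 < A $ k $ j \<and> b $ k = 0"
  proof -
    \<comment> \<open>The element 1 keeps the set nonempty for a zero column, where
      \<open>gamma_star\<close> is infinite; it also makes the minimum a real number in that
      case.\<close>
    let ?R = "insert 1 ((\<lambda>k. b $ k / A $ k $ j) ` {k. 0 < A $ k $ j})"
    have "b $ k > 0" if "0 < A $ k $ j" for k
      using no that assms(2) by (metis less_eq_real_def nonneg_vec_def)
    then have "0 < Min ?R" by (subst Min_gr_iff) auto
    moreover have "A $ k $ j * Min ?R \<le> b $ k" for k
    proof (cases "0 < A $ k $ j")
      case True
      then have "Min ?R \<le> b $ k / A $ k $ j" by (intro Min_le) auto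
      then show ?thesis using True by (simp add: field_simps)
    next
      case False
      then have "A $ k $ j = 0" using assms(1) by (metis less_eq_real_def nonneg_mat_def)
      then show ?thesis using assms(2) by (simp add: nonneg_vec_def)
    qed
    ultimately show ?thesis by blast
  qed
  have "0 < gamma_star A b j" if no: "\<nexists>k. 0 < A $ k $ j \<and> b $ k = 0"
  proof -
    obtain c where c: "c > 0" "\<forall>k. A $ k $ j * c \<le> b $ k" using step[OF no] by auto
    have "ennreal c * ennreal (A $ k $ j) \<le> ennreal (b $ k)" for k
      using c assms by (simp add: ennreal_mult[symmetric] nonneg_mat_def ennreal_leI mult.commute)
    then have "ennreal c \<le> gamma_star A b j" unfolding gamma_star_def by (intro Sup_upper) simp
    then show ?thesis using c by (meson ennreal_less_zero_iff less_le_trans)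
  qed
  then show "gamma_star A b j = 0 \<longleftrightarrow> (\<exists>k. 0 < A $ k $ j \<and> b $ k = 0)"
    using zero by force
  then show "gamma_star A b j \<noteq> 0 \<Longrightarrow> \<exists>c>0. \<forall>k. A $ k $ j * c \<le> b $ k"
    using step by blast
qed

section \<open>Critical cycles and supports of eigenvectors\<close>

lemma wf_matrix_digraph: "wf_digraph (matrix_digraph A)"
  by unfold_locales (auto simp: matrix_digraph_def)

text \<open>All arc weights are positive, hence so is their geometric mean. This excludes
  \<open>lam = 0\<close> on the graph side of the theorem.\<close>

lemma critical_cycle_pos:
  assumes "critical_cycle A x lam p"
  shows "0 < lam"
proof -
  have c: "pre_digraph.cycle (matrix_digraph A) p" and m: "cycle_mean A p = lam"
    using assms by (auto simp: critical_cycle_def)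
  have "p \<noteq> []" using c by (auto simp: pre_digraph.cycle_def)
  have "set p \<subseteq> arcs (matrix_digraph A)"
    using c wf_digraph.cycle_imp_arcs[OF wf_matrix_digraph] by blast
  then have "\<forall>e\<in>set p. 0 < A $ fst e $ snd e" by (auto simp: matrix_digraph_def)
  then have "0 < (\<Prod>e\<leftarrow>p. A $ fst e $ snd e)" by (induction p) auto
  then show ?thesis using m \<open>p \<noteq> []\<close> by (auto simp: cycle_mean_def)
qed

text \<open>A positive product \<open>A $ i $ j * x $ j\<close> is a lower bound for
  \<open>lam * x $ i\<close>.\<close>

lemma supp_backward:
  assumes "nonneg_mat A" and "x \<in> V A lam" and "0 < A $ i $ j" and "j \<in> supp x"
  shows "i \<in> supp x"
proof -
  have "0 < A $ i $ j * x $ j" using assms by (simp add: supp_def)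
  also have "\<dots> \<le> lam * x $ i" using assms by (simp add: V_iff)
  finally have "x $ i \<noteq> 0" by auto
  then show ?thesis using assms(2) by (simp add: supp_def V_iff less_le)
qed

lemma supp_reachable:
  assumes "nonneg_mat A" and "x \<in> V A lam" and "i \<rightarrow>\<^sup>*\<^bsub>matrix_digraph A\<^esub> j" and "j \<in> supp x"
  shows "i \<in> supp x"
proof -
  interpret wf_digraph "matrix_digraph A" by (rule wf_matrix_digraph)
  show ?thesis using assms(3,4)
  proof (induction rule: converse_reachable_induct)
    case (step u v)
    then have "0 < A $ u $ v" by (auto simp: matrix_digraph_def arcs_ends_def arc_to_ends_def)
    then show ?case using step supp_backward assms by blast
  qed
qed

text \<open>The support of an eigenvector is closed under predecessors, so a cycle that meets
  \<open>supp x\<close> lies in it entirely. Each critical cycle for \<open>z\<close> is therefore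
  either critical for \<open>x\<close> or disjoint from \<open>supp x\<close>.\<close>

lemma Gc_eq_restrict_nodes:
  assumes A: "nonneg_mat A" and x: "x \<in> V A lam" and sub: "supp x \<subseteq> supp z"
  shows "Gc A x lam = restrict_nodes (Gc A z lam) (supp x)"
proof -
  interpret wf_digraph "matrix_digraph A" by (rule wf_matrix_digraph)
  have iff: "critical_cycle A x lam p \<longleftrightarrow>
      critical_cycle A z lam p \<and> fst ` set p \<inter> supp x \<noteq> {}" for p
  proof -
    have cyc: "fst f \<in> supp x" if "cycle p" "e \<in> set p" "fst e \<in> supp x" "f \<in> set p" for e f
    proof -
      have "fst f \<rightarrow>\<^sup>*\<^bsub>matrix_digraph A\<^esub> fst e"
        using cycle_arc_reachable[OF that(1,4,2)] by (simp add: matrix_digraph_def)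
      then show ?thesis using supp_reachable[OF A x _ that(3)] by blast
    qed
    have "fst ` set p \<subseteq> supp x \<longleftrightarrow>
        fst ` set p \<subseteq> supp z \<and> fst ` set p \<inter> supp x \<noteq> {}" if c: "cycle p"
    proof -
      have "fst ` set p \<noteq> {}" using c by (auto simp: cycle_def)
      moreover have "fst ` set p \<subseteq> supp x" if ne: "fst ` set p \<inter> supp x \<noteq> {}"
      proof -
        obtain e where "e \<in> set p" "fst e \<in> supp x" using ne by auto
        then show ?thesis using cyc[OF c] by (intro image_subsetI)
      qed
      ultimately show ?thesis using sub by (metis Int_absorb2 order_trans)
    qed
    then show ?thesis unfolding critical_cycle_def by metis
  qed
  have heads: "snd ` set p = fst ` set p" if "critical_cycle A z lam p" for z p
    using cycle_heads_eq_tails[of p] that by (simp add: critical_cycle_def matrix_digraph_def)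
  have v: "verts (Gc A x lam) = verts (Gc A z lam) \<inter> supp x"
  proof (intro equalityI subsetI)
    fix i assume "i \<in> verts (Gc A x lam)"
    then obtain p where p: "critical_cycle A x lam p" "i \<in> fst ` set p" by (auto simp: Gc_def)
    then have "i \<in> supp x" unfolding critical_cycle_def by blast
    then show "i \<in> verts (Gc A z lam) \<inter> supp x" using p iff[of p] by (auto simp: Gc_def)
  next
    fix i assume i: "i \<in> verts (Gc A z lam) \<inter> supp x"
    then obtain p where p: "critical_cycle A z lam p" "i \<in> fst ` set p" by (auto simp: Gc_def)
    then have "critical_cycle A x lam p" using i iff by blast
    then show "i \<in> verts (Gc A x lam)" using p by (auto simp: Gc_def)
  qed
  have "arcs (Gc A x lam) = {e \<in> arcs (Gc A z lam). fst e \<in> verts (Gc A z lam) \<inter> supp x \<and>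
      snd e \<in> verts (Gc A z lam) \<inter> supp x}" (is "_ = ?R")
  proof
    show "arcs (Gc A x lam) \<subseteq> ?R"
    proof
      fix e assume "e \<in> arcs (Gc A x lam)"
      then obtain p where p: "critical_cycle A x lam p" "e \<in> set p" by (auto simp: Gc_def)
      then have "fst e \<in> fst ` set p" "snd e \<in> fst ` set p"
        using heads[OF p(1)] by (metis imageI)+
      then have "fst e \<in> verts (Gc A x lam)" "snd e \<in> verts (Gc A x lam)"
        using p(1) by (auto simp: Gc_def)
      then show "e \<in> ?R" using v p iff by (auto simp: Gc_def)
    qed
    show "?R \<subseteq> arcs (Gc A x lam)" using iff by (fastforce simp: Gc_def)
  qed
  then show ?thesis using v by (simp add: restrict_nodes_def induce_subgraph_def Gc_def)
qed

section \<open>Tight arcs and their cycles\<close>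

text \<open>The condition \<open>0 < x $ i\<close> discards rows outside the support: there, for an
  eigenvector of a nonnegative matrix, both sides are 0 for every \<open>j\<close>.\<close>

definition tight :: "real ^ 'n ^ 'n \<Rightarrow> real ^ 'n \<Rightarrow> real \<Rightarrow> ('n \<times> 'n) set"
  where "tight A x lam = {(i, j). 0 < x $ i \<and> A $ i $ j * x $ j = lam * x $ i}"

text \<open>With all of \<open>UNIV\<close> as node set, every node is reachable from
  itself.\<close>

definition tight_digraph :: "real ^ 'n ^ 'n \<Rightarrow> real ^ 'n \<Rightarrow> real \<Rightarrow> ('n, 'n \<times> 'n) pre_digraph"
  where "tight_digraph A x lam =
    \<lparr> verts = UNIV, arcs = tight A x lam, tail = fst, head = snd \<rparr>"

lemma wf_tight_digraph: "wf_digraph (tight_digraph A x lam)"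
  by unfold_locales (auto simp: tight_digraph_def)

lemma tight_pos:
  assumes "nonneg_mat A" and "nonneg_vec x" and "0 < lam" and "(i, j) \<in> tight A x lam"
  shows "0 < A $ i $ j" and "0 < x $ j"
proof -
  have "0 < A $ i $ j * x $ j" using assms by (simp add: tight_def)
  then show "0 < A $ i $ j" "0 < x $ j"
    using assms(1,2) by (simp_all add: nonneg_mat_def nonneg_vec_def zero_less_mult_iff not_less[symmetric])
qed

text \<open>Some column attains the maximum in each row, which gives an outgoing tight arc at every
  node of the support.\<close>

lemma fst_tight:
  assumes "x \<in> V A lam"
  shows "fst ` tight A x lam = supp x"
proof
  show "fst ` tight A x lam \<subseteq> supp x" by (auto simp: tight_def supp_def)
  show "supp x \<subseteq> fst ` tight A x lam"
  proof
    fix i assume i: "i \<in> supp x"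
    obtain j where "A $ i $ j * x $ j = lam * x $ i" using assms unfolding V_iff by blast
    then have "(i, j) \<in> tight A x lam" using i by (simp add: tight_def supp_def)
    then show "i \<in> fst ` tight A x lam" by force
  qed
qed

text \<open>One strict inequality between positive factors would make the whole product strictly
  smaller.\<close>

lemma prod_list_eq_imp_pointwise_eq:
  fixes f g :: "'a \<Rightarrow> real"
  assumes "\<And>e. e \<in> set p \<Longrightarrow> 0 < f e \<and> f e \<le> g e"
    and "(\<Prod>e\<leftarrow>p. f e) = (\<Prod>e\<leftarrow>p. g e)" and "e \<in> set p"
  shows "f e = g e"
proof -
  have le: "0 < (\<Prod>e\<leftarrow>q. f e) \<and> (\<Prod>e\<leftarrow>q. f e) \<le> (\<Prod>e\<leftarrow>q. g e)" if "set q \<subseteq> set p" for q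
    using that
  proof (induction q)
    case (Cons a q)
    then have "0 < f a" "f a \<le> g a" using assms(1)[of a] by auto
    with Cons show ?case by (auto intro!: mult_mono mult_pos_pos)
  qed simp
  obtain q r where p: "p = q @ e # r" using assms(3) by (meson split_list)
  have "\<not> f e < g e"
  proof
    assume "f e < g e"
    have "(\<Prod>e\<leftarrow>q @ r. f e) * f e < (\<Prod>e\<leftarrow>q @ r. g e) * g e"
      using le[of "q @ r"] assms(1)[OF assms(3)] p \<open>f e < g e\<close>
      by (intro mult_le_less_imp_less) auto
    then show False using assms(2) p by (simp add: mult_ac)
  qed
  then show ?thesis using assms(1,3) by force
qed

text \<open>A telescoping product: each inner node of the walk is the head of one arc and the tail
  of the next.\<close>

lemma (in pre_digraph) prod_list_cas:
  fixes x :: "'a \<Rightarrow> real"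
  assumes "cas u p v"
  shows "(\<Prod>e\<leftarrow>p. x (tail G e)) * x v = x u * (\<Prod>e\<leftarrow>p. x (head G e))"
  using assms by (induction p arbitrary: u) (auto simp: mult_ac)

text \<open>Along a cycle the entries of \<open>x\<close> cancel from the product of the
  inequalities \<open>A $ i $ j * x $ j \<le> lam * x $ i\<close>. Mean \<open>lam\<close> thus says
  that the two products agree, which forces equality in every factor.\<close>

lemma critical_cycle_iff:
  assumes A: "nonneg_mat A" and x: "x \<in> V A lam" and lam: "0 < lam"
  shows "critical_cycle A x lam p \<longleftrightarrow> pre_digraph.cycle (tight_digraph A x lam) p"
proof -
  let ?G = "matrix_digraph A" and ?T = "tight_digraph A x lam"
  interpret G: wf_digraph ?G by (rule wf_matrix_digraph)
  interpret T: wf_digraph ?T by (rule wf_tight_digraph)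
  have x0: "nonneg_vec x" using x by (simp add: V_def)
  have TG: "tight A x lam \<subseteq> arcs ?G"
    using tight_pos[OF A x0 lam] by (auto simp: matrix_digraph_def)
  have prods: "(\<Prod>e\<leftarrow>p. A $ fst e $ snd e * x $ snd e) =
      (\<Prod>e\<leftarrow>p. A $ fst e $ snd e) * (\<Prod>e\<leftarrow>p. x $ snd e)"
    "(\<Prod>e\<leftarrow>p. lam * x $ fst e) = lam ^ length p * (\<Prod>e\<leftarrow>p. x $ fst e)"
    by (induction p) (auto simp: mult_ac)
  \<comment> \<open>The walk returns to \<open>u\<close>, and \<open>0 < x $ u\<close> allows this
    factor to be cancelled in \<open>prod_list_cas\<close>.\<close>
  have closed: "(\<Prod>e\<leftarrow>p. x $ fst e) = (\<Prod>e\<leftarrow>p. x $ snd e)"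
      "0 < (\<Prod>e\<leftarrow>p. x $ fst e)"
    if c: "G.cycle p" and s: "fst ` set p \<subseteq> supp x"
  proof -
    obtain u where u: "G.awalk u p u" and "p \<noteq> []" using c by (auto simp: G.cycle_def)
    then have "u = fst (hd p)" using G.closed_awalk_ends[OF u] by (simp add: matrix_digraph_def)
    then have "u \<in> fst ` set p" using \<open>p \<noteq> []\<close> by simp
    then have "0 < x $ u" using s by (auto simp: supp_def)
    then show "(\<Prod>e\<leftarrow>p. x $ fst e) = (\<Prod>e\<leftarrow>p. x $ snd e)"
      using G.prod_list_cas[of u p u "\<lambda>i. x $ i"] u unfolding G.awalk_def
      by (simp add: matrix_digraph_def)
    have "\<forall>e\<in>set p. 0 < x $ fst e" using s by (auto simp: supp_def)
    then show "0 < (\<Prod>e\<leftarrow>p. x $ fst e)" by (induction p) auto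
  qed
  show ?thesis
  proof
    assume cc: "critical_cycle A x lam p"
    then have c: "G.cycle p" and s: "fst ` set p \<subseteq> supp x" and m: "cycle_mean A p = lam"
      by (auto simp: critical_cycle_def)
    have ne: "p \<noteq> []" using c by (auto simp: G.cycle_def)
    have arc: "0 < A $ fst e $ snd e" if "e \<in> set p" for e
      using G.cycle_imp_arcs[OF c] that by (auto simp: matrix_digraph_def)
    \<comment> \<open>Nonnegativity ensures that taking the power undoes
      \<open>root\<close>.\<close>
    have "0 \<le> (\<Prod>e\<leftarrow>p. A $ fst e $ snd e)"
      using A by (auto intro!: prod_list_nonneg simp: nonneg_mat_def)
    then have "(\<Prod>e\<leftarrow>p. A $ fst e $ snd e) = lam ^ length p"
      using m ne by (auto simp: cycle_mean_def)
    then have eq: "(\<Prod>e\<leftarrow>p. A $ fst e $ snd e * x $ snd e) = (\<Prod>e\<leftarrow>p. lam * x $ fst e)"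
      using prods closed[OF c s] by simp
    have "snd e \<in> fst ` set p" if "e \<in> set p" for e
      using G.cycle_heads_eq_tails[OF c] that by (auto simp: matrix_digraph_def)
    then have "0 < x $ snd e" if "e \<in> set p" for e
      using s that unfolding supp_def by blast
    then have "0 < A $ fst e $ snd e * x $ snd e \<and> A $ fst e $ snd e * x $ snd e \<le> lam * x $ fst e"
      if "e \<in> set p" for e
      using arc that x by (simp add: V_iff)
    then have "A $ fst e $ snd e * x $ snd e = lam * x $ fst e" if "e \<in> set p" for e
      using prod_list_eq_imp_pointwise_eq[OF _ eq that] by blast
    then have "set p \<subseteq> tight A x lam" using s by (fastforce simp: tight_def supp_def)
    then show "T.cycle p"
      using G.cycle_transfer[of ?T p] c T.wf_digraph_axioms
      by (simp add: tight_digraph_def matrix_digraph_def)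
  next
    assume c: "T.cycle p"
    then have sub: "set p \<subseteq> tight A x lam"
      using T.cycle_imp_arcs by (auto simp: tight_digraph_def)
    then have cG: "G.cycle p"
      using T.cycle_transfer[of ?G p] c G.wf_digraph_axioms TG
      by (simp add: tight_digraph_def matrix_digraph_def)
    have s: "fst ` set p \<subseteq> supp x" using sub by (auto simp: tight_def supp_def)
    have ne: "p \<noteq> []" using c by (auto simp: T.cycle_def)
    have "map (\<lambda>e. A $ fst e $ snd e * x $ snd e) p = map (\<lambda>e. lam * x $ fst e) p"
      using sub by (auto simp: tight_def)
    then have "(\<Prod>e\<leftarrow>p. A $ fst e $ snd e * x $ snd e) = (\<Prod>e\<leftarrow>p. lam * x $ fst e)"
      by (rule arg_cong)
    then have "(\<Prod>e\<leftarrow>p. A $ fst e $ snd e) = lam ^ length p"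
      using prods closed[OF cG s] by simp
    then have "cycle_mean A p = lam"
      using ne lam by (simp add: cycle_mean_def real_root_power_cancel)
    then show "critical_cycle A x lam p" using cG s by (simp add: critical_cycle_def)
  qed
qed

text \<open>A tight arc lies on a critical cycle exactly when tight arcs lead back from its head to
  its tail. Such a cycle consists of arcs of \<open>Gc A x lam\<close>, so the way back exists there
  too.\<close>

lemma Gc_tight:
  assumes A: "nonneg_mat A" and x: "x \<in> V A lam" and lam: "0 < lam"
  shows "arcs (Gc A x lam) = {(i, j) \<in> tight A x lam. j \<rightarrow>\<^sup>*\<^bsub>tight_digraph A x lam\<^esub> i}"
    and "verts (Gc A x lam) = fst ` arcs (Gc A x lam)"
    and "verts (Gc A x lam) = snd ` arcs (Gc A x lam)"
    and "wf_digraph (Gc A x lam)"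
    and "\<And>e. e \<in> arcs (Gc A x lam) \<Longrightarrow> snd e \<rightarrow>\<^sup>*\<^bsub>Gc A x lam\<^esub> fst e"
proof -
  let ?T = "tight_digraph A x lam" and ?C = "Gc A x lam"
  interpret T: wf_digraph ?T by (rule wf_tight_digraph)
  have sel: "tail ?T = fst" "head ?T = snd" "arcs ?T = tight A x lam"
    "tail ?C = fst" "head ?C = snd"
    by (simp_all add: tight_digraph_def Gc_def)
  have arcs: "arcs ?C = (\<Union>p\<in>{p. T.cycle p}. set p)"
    and verts: "verts ?C = (\<Union>p\<in>{p. T.cycle p}. fst ` set p)"
    by (simp_all add: Gc_def critical_cycle_iff[OF assms])
  show "arcs ?C = {(i, j) \<in> tight A x lam. j \<rightarrow>\<^sup>*\<^bsub>?T\<^esub> i}"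
  proof (intro equalityI subsetI)
    fix e assume "e \<in> arcs ?C"
    then show "e \<in> {(i, j) \<in> tight A x lam. j \<rightarrow>\<^sup>*\<^bsub>?T\<^esub> i}"
      using T.cycle_imp_arcs T.cycle_head_reaches_tail unfolding arcs sel by fastforce
  next
    fix e assume "e \<in> {(i, j) \<in> tight A x lam. j \<rightarrow>\<^sup>*\<^bsub>?T\<^esub> i}"
    then have "e \<in> arcs ?T" "head ?T e \<rightarrow>\<^sup>*\<^bsub>?T\<^esub> tail ?T e" unfolding sel by auto
    then obtain p where "T.cycle p" "e \<in> set p" by (rule T.cycle_through_arc)
    then show "e \<in> arcs ?C" unfolding arcs by blast
  qed
  show v: "verts ?C = fst ` arcs ?C" using arcs verts by blast
  have "snd ` set p = fst ` set p" if "T.cycle p" for p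
    using T.cycle_heads_eq_tails[OF that] unfolding sel .
  then have "snd ` arcs ?C = fst ` arcs ?C" unfolding arcs by (simp add: image_UN)
  then show v': "verts ?C = snd ` arcs ?C" using v by simp
  show wf: "wf_digraph ?C"
    by unfold_locales (simp_all add: sel v, metis imageI v v')
  interpret C: wf_digraph ?C by (rule wf)
  fix e assume "e \<in> arcs ?C"
  then obtain p where p: "T.cycle p" "e \<in> set p" using arcs by blast
  have "set p \<subseteq> arcs ?C" using arcs p by blast
  then have "C.cycle p" using T.cycle_transfer[OF wf _ _ p(1)] sel by simp
  then show "snd e \<rightarrow>\<^sup>*\<^bsub>?C\<^esub> fst e" using C.cycle_head_reaches_tail[OF _ p(2)] sel by simp
qed

text \<open>Turns condition (iv) into a statement on out-degrees. In \<open>Gc A x lam\<close> every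
  arc can be returned from and every node has an outgoing arc, as the two digraph criteria
  require.\<close>

lemma sccs_cycle_iff:
  assumes "nonneg_mat A" and "x \<in> V A lam" and "0 < lam"
  shows "(\<forall>H\<in>pre_digraph.sccs (Gc A x lam). is_cycle_graph H) \<longleftrightarrow>
    inj_on fst (arcs (Gc A x lam))"
proof -
  interpret wf_digraph "Gc A x lam" using Gc_tight(4)[OF assms] .
  have sel: "tail (Gc A x lam) = fst" "head (Gc A x lam) = snd" by (simp_all add: Gc_def)
  show ?thesis
    using inj_on_tail_if_sccs_cycle sccs_cycle_if_inj_on_tail Gc_tight(5)[OF assms]
      Gc_tight(2)[OF assms]
    unfolding sel by (metis subset_refl)
qed

section \<open>Characterising simple image eigenvectors by tight arcs\<close>

lemma simple_image_eigenvector_imp_pos: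
  assumes A: "nonneg_mat A" and "0 \<le> lam" and s: "simple_image_eigenvector A lam b"
  shows "0 < lam"
proof (rule ccontr)
  assume "\<not> 0 < lam"
  then have "lam = 0" using assms by simp
  have b: "b \<in> V A lam" "b \<noteq> 0" using s by (auto simp: simple_image_eigenvector_def)
  then obtain j where "b $ j \<noteq> 0" by (auto simp: vec_eq_iff)
  then have j: "0 < b $ j" using b by (simp add: V_iff less_le)
  have "A $ k $ j = 0" for k
  proof -
    have "A $ k $ j * b $ j \<le> 0" using b(1) \<open>lam = 0\<close> unfolding V_iff by simp
    then show ?thesis using j A by (simp add: mult_le_0_iff nonneg_mat_def antisym)
  qed
  moreover obtain y where y: "nonneg_vec y" "A \<otimes>\<^sub>m y = b"
    using s by (auto simp: simple_image_eigenvector_def)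
  \<comment> \<open>Column \<open>j\<close> is zero, and \<open>b\<close> is nonnegative, so raising
    this entry by 1 leaves a solution.\<close>
  ultimately have "y $ j = y $ j + 1"
    using b(1)
    by (intro simple_image_eigenvector_update[OF s y]) (auto simp: nonneg_vec_def V_iff)
  then show False by simp
qed

text \<open>The last two conditions say that the tight arcs form a permutation of
  \<open>supp b\<close>. Uniqueness gives each column of the support a row that is tight in this
  column alone. Conversely, tight arcs into the support bound any solution above by
  \<open>b / lam\<close>, and rows with a single tight arc force equality.\<close>

lemma simple_image_eigenvector_iff:
  assumes A: "nonneg_mat A" and b: "b \<in> V A lam" "b \<noteq> 0" and lam: "0 < lam"
  shows "simple_image_eigenvector A lam b \<longleftrightarrow>
    (\<forall>i. i \<notin> supp b \<longrightarrow> gamma_star A b i = 0) \<and>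
    inj_on fst (tight A b lam) \<and> snd ` tight A b lam = supp b"
    (is "_ \<longleftrightarrow> ?R")
proof
  let ?T = "tight A b lam"
  have b0: "nonneg_vec b" using b by (simp add: V_def)
  have sub: "snd ` ?T \<subseteq> supp b" using tight_pos[OF A b0 lam] by (auto simp: supp_def)
  define y where "y = (1 / lam) *\<^sub>R b"
  have y: "nonneg_vec y" "A \<otimes>\<^sub>m y = b" and y_nth: "y $ i = b $ i / lam" for i
    using b lam by (auto simp: y_def nonneg_vec_def V_iff maxmult_eq_iff field_simps)
  show ?R if s: "simple_image_eigenvector A lam b"
  proof (intro conjI allI impI)
    fix i assume i: "i \<notin> supp b"
    show "gamma_star A b i = 0"
    proof (rule ccontr)
      assume g: "gamma_star A b i \<noteq> 0"
      then obtain c where c: "c > 0" "\<And>k. A $ k $ i * c \<le> b $ k"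
        using gamma_star_eq_0_iff(2)[OF A b0] by blast
      have yi: "y $ i = 0" using i b0 by (simp add: y_nth supp_def nonneg_vec_def antisym not_less)
      have "A $ k $ i * c = b $ k" if "b $ k = 0" for k
      proof -
        have "\<not> 0 < A $ k $ i" using g gamma_star_eq_0_iff(1)[OF A b0] that by blast
        then have "A $ k $ i = 0" using A by (simp add: nonneg_mat_def antisym)
        then show ?thesis using that by simp
      qed
      \<comment> \<open>This entry of \<open>y\<close> is 0, so it attains the maximum only in rows
        with \<open>b $ k = 0\<close>, where the new entry attains it as well.\<close>
      then have "y $ i = c"
        using c yi by (intro simple_image_eigenvector_update[OF s y]) auto
      then show False using c yi by simp
    qed
  next
    have "\<exists>i. (i, j) \<in> ?T \<and> (\<forall>l. (i, l) \<in> ?T \<longrightarrow> l = j)" if j: "j \<in> supp b" for j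
    proof (rule ccontr)
      assume no: "\<not> ?thesis"
      \<comment> \<open>Every row that is tight in column \<open>j\<close> is also tight in another
        column, so the entry can be lowered to 0.\<close>
      have "y $ j = 0"
      proof (rule simple_image_eigenvector_update[OF s y])
        fix k assume k: "A $ k $ j * y $ j = b $ k"
        show "A $ k $ j * 0 = b $ k \<or> (\<exists>l. l \<noteq> j \<and> A $ k $ l * y $ l = b $ k)"
        proof (cases "b $ k = 0")
          case False
          then have bk: "0 < b $ k" using b0 by (simp add: nonneg_vec_def less_le)
          then have "(k, j) \<in> ?T" using k lam by (simp add: tight_def y_nth field_simps)
          then obtain l where "(k, l) \<in> ?T" "l \<noteq> j" using no by blast
          then show ?thesis using lam by (auto simp: tight_def y_nth field_simps)
        qed simp
      qed (use b0 in \<open>auto simp: nonneg_vec_def\<close>)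
      then show False using j lam by (simp add: y_nth supp_def)
    qed
    then obtain r where r: "\<And>j. j \<in> supp b \<Longrightarrow> (r j, j) \<in> ?T"
      "\<And>j l. j \<in> supp b \<Longrightarrow> (r j, l) \<in> ?T \<Longrightarrow> l = j" by metis
    have "inj_on r (supp b)" using r by (metis inj_onI)
    moreover have "r ` supp b \<subseteq> supp b" using r(1) by (fastforce simp: tight_def supp_def)
    \<comment> \<open>An injective self-map of a finite set is onto, so every row of the support is
      the private row \<open>r j\<close> of some column.\<close>
    ultimately have surj: "r ` supp b = supp b" by (simp add: endo_inj_surj)
    show "inj_on fst ?T"
    proof (rule inj_onI)
      fix e f assume ef: "e \<in> ?T" "f \<in> ?T" "fst e = fst f"
      then have "fst e \<in> r ` supp b" using surj fst_tight[OF b(1)] by blast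
      then obtain j where "j \<in> supp b" "fst e = r j" by blast
      then show "e = f" using r(2)[of j] ef by (metis prod.collapse)
    qed
    show "snd ` ?T = supp b" using sub r(1) by force
  qed
  show "simple_image_eigenvector A lam b" if R: ?R
  proof -
    have "z = y" if z: "nonneg_vec z" "A \<otimes>\<^sub>m z = b" for z
    proof (rule vec_eq_iff[THEN iffD2], rule allI)
      fix j
      have le: "A $ k $ l * z $ l \<le> b $ k" for k l using z(2) by (simp add: maxmult_eq_iff)
      have z0: "0 \<le> z $ l" for l using z(1) by (simp add: nonneg_vec_def)
      show "z $ j = y $ j"
      proof (cases "j \<in> supp b")
        case False
        then obtain k where k: "0 < A $ k $ j" "b $ k = 0"
          using R gamma_star_eq_0_iff(1)[OF A b0] by blast
        then have "z $ j = 0" using le[of k j] z0[of j] by (simp add: mult_le_0_iff)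
        moreover have "b $ j = 0" using False b0 by (simp add: supp_def nonneg_vec_def antisym not_less)
        ultimately show ?thesis by (simp add: y_nth)
      next
        case True
        have upper: "A $ i $ l * z $ l \<le> A $ i $ l * (b $ l / lam)" if l: "l \<in> supp b" for i l
        proof -
          obtain k where k: "(k, l) \<in> ?T" using R l by force
          have "A $ k $ l * z $ l \<le> A $ k $ l * (b $ l / lam)"
            using le[of k l] k lam by (simp add: tight_def field_simps)
          then have "z $ l \<le> b $ l / lam"
            using tight_pos(1)[OF A b0 lam k] by (metis mult_le_cancel_left_pos)
          then show ?thesis using A unfolding nonneg_mat_def by (intro mult_left_mono) auto
        qed
        obtain i where i: "(i, j) \<in> ?T" using R True by force
        then have bi: "0 < b $ i" by (simp add: tight_def)
        \<comment> \<open>A column in which \<open>z\<close> attains the maximum of row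
          \<open>i\<close>. By \<open>upper\<close> the arc \<open>(i, l)\<close> is tight, and
          injectivity then gives \<open>l = j\<close>.\<close>
        obtain l where l: "A $ i $ l * z $ l = b $ i" using z(2) by (auto simp: maxmult_eq_iff)
        have "l \<in> supp b"
        proof (rule ccontr)
          assume "l \<notin> supp b"
          then obtain k where k: "0 < A $ k $ l" "b $ k = 0"
            using R gamma_star_eq_0_iff(1)[OF A b0] by blast
          then have "z $ l = 0" using le[of k l] z0[of l] by (simp add: mult_le_0_iff)
          then show False using l bi by simp
        qed
        then have "b $ i \<le> A $ i $ l * (b $ l / lam)" using upper[of l i] l by simp
        then have "lam * b $ i \<le> A $ i $ l * b $ l" using lam by (simp add: field_simps)
        then have "(i, l) \<in> ?T" using b(1) bi by (auto simp: tight_def V_iff antisym)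
        then have "l = j" using i R inj_onD[of fst ?T "(i, l)" "(i, j)"] by simp
        then have "A $ i $ j * z $ j = A $ i $ j * y $ j"
          using l i lam by (simp add: tight_def y_nth field_simps)
        then show ?thesis using tight_pos(1)[OF A b0 lam i] by simp
      qed
    qed
    then show ?thesis using b y unfolding simple_image_eigenvector_def by blast
  qed
qed

text \<open>In a permutation of a finite set every arc lies on a cycle. Proof by counting: for an
  arc \<open>(i, j)\<close>, successors inject the set reachable from \<open>i\<close> into the one
  reachable from \<open>j\<close>. The latter is a subset of the former, so both agree and
  \<open>i\<close> is reachable from \<open>j\<close>.\<close>

lemma arcs_Gc_eq_tight:
  assumes A: "nonneg_mat A" and b: "b \<in> V A lam" and lam: "0 < lam"
    and inj: "inj_on fst (tight A b lam)" and surj: "snd ` tight A b lam = supp b"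
  shows "arcs (Gc A b lam) = tight A b lam"
proof -
  let ?T = "tight A b lam"
  interpret T: wf_digraph "tight_digraph A b lam" by (rule wf_tight_digraph)
  have adj: "i \<rightarrow>\<^bsub>tight_digraph A b lam\<^esub> j \<longleftrightarrow> (i, j) \<in> ?T" for i j
    by (force simp: tight_digraph_def arcs_ends_def arc_to_ends_def)
  have refl: "i \<rightarrow>\<^sup>*\<^bsub>tight_digraph A b lam\<^esub> i" for i
    by (rule T.reachable_refl) (simp add: tight_digraph_def)
  have card: "card ?T = card (supp b)"
    using card_image[OF inj] fst_tight[OF b] by simp
  then have inj': "inj_on snd ?T" using surj by (intro eq_card_imp_inj_on) auto
  have "j \<rightarrow>\<^sup>*\<^bsub>tight_digraph A b lam\<^esub> i" if ij: "(i, j) \<in> ?T" for i j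
  proof -
    let ?R = "\<lambda>i. {k. i \<rightarrow>\<^sup>*\<^bsub>tight_digraph A b lam\<^esub> k}"
    define S where "S = {e \<in> ?T. fst e \<in> ?R i}"
    have R: "?R i \<subseteq> supp b"
    proof
      fix k assume "k \<in> ?R i"
      then have "i \<rightarrow>\<^sup>*\<^bsub>tight_digraph A b lam\<^esub> k" by simp
      then show "k \<in> supp b"
      proof (induction rule: T.reachable_induct)
        case base
        then show ?case using ij fst_tight[OF b] by force
      next
        case (step v w)
        then have "snd (v, w) \<in> snd ` ?T" using adj by blast
        then show ?case using surj by simp
      qed
    qed
    have "fst ` S = fst ` ?T \<inter> ?R i" unfolding S_def by blast
    then have "fst ` S = ?R i" using R fst_tight[OF b] by blast
    moreover have "inj_on fst S" "inj_on snd S"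
      using inj inj' by (auto simp: S_def intro: inj_on_subset)
    ultimately have c: "card (snd ` S) = card (?R i)" by (metis card_image)
    \<comment> \<open>The only tight arc out of \<open>i\<close> leads to \<open>j\<close>, so every
      nonempty walk from \<open>i\<close> passes through \<open>j\<close>.\<close>
    have "snd ` S \<subseteq> ?R j"
    proof
      fix l assume "l \<in> snd ` S"
      then obtain k where k: "i \<rightarrow>\<^sup>*\<^bsub>tight_digraph A b lam\<^esub> k" "(k, l) \<in> ?T"
        by (auto simp: S_def)
      from k show "l \<in> ?R j"
      proof (induction arbitrary: l rule: T.reachable_induct)
        case base
        then have "l = j" using inj_onD[OF inj, of "(i, l)" "(i, j)"] ij by simp
        then show ?case using refl by simp
      next
        case (step v w)
        then have "j \<rightarrow>\<^sup>*\<^bsub>tight_digraph A b lam\<^esub> w" using adj by auto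
        then show ?case using step adj T.reachable_adj_trans by blast
      qed
    qed
    moreover have "?R j \<subseteq> ?R i" using ij adj by (auto intro: T.adj_reachable_trans)
    ultimately have "?R j = ?R i" using c
      by (metis (no_types, lifting) card_seteq finite order_trans order_refl order_antisym)
    moreover have "i \<in> ?R i" using refl by simp
    ultimately show ?thesis by blast
  qed
  then show ?thesis using Gc_tight(1)[OF A b lam] by auto
qed

text \<open>
  The number of nodes reachable along tight arcs is constant on strongly connected components of
  the tight digraph and decreases strictly along all other tight arcs.
\<close>

lemma strict_visualization:
  fixes A :: "real ^ 'n ^ 'n"
  assumes A: "nonneg_mat A" and x: "x \<in> V A lam" and lam: "0 < lam"
    and nodes: "supp x = Nc A x lam"
  obtains b where "b \<in> V A lam" and "supp b = supp x" and "tight A b lam = arcs (Gc A x lam)"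
proof -
  let ?T = "tight A x lam" and ?C = "arcs (Gc A x lam)" and ?n = "CARD('n)"
  interpret T: wf_digraph "tight_digraph A x lam" by (rule wf_tight_digraph)
  have adj: "i \<rightarrow>\<^bsub>tight_digraph A x lam\<^esub> j \<longleftrightarrow> (i, j) \<in> ?T" for i j
    by (force simp: tight_digraph_def arcs_ends_def arc_to_ends_def)
  define R where "R i = {k. i \<rightarrow>\<^sup>*\<^bsub>tight_digraph A x lam\<^esub> k}" for i
  define h where "h i = card (R i)" for i
  have C: "?C = {(i, j) \<in> ?T. i \<in> R j}" using Gc_tight(1)[OF A x lam] by (simp add: R_def)
  have h_le: "h i \<le> ?n" for i unfolding h_def by (simp add: card_mono)
  have R_sub: "R j \<subseteq> R i" if "(i, j) \<in> ?T" for i j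
    using that adj by (auto simp: R_def intro: T.adj_reachable_trans)
  have h_eq: "h j = h i" if "(i, j) \<in> ?C" for i j
  proof -
    have "R i \<subseteq> R j" using that C by (auto simp: R_def intro: T.reachable_trans)
    then show ?thesis using R_sub[of i j] that C by (auto simp: h_def)
  qed
  have h_less: "h j < h i" if "(i, j) \<in> ?T" "(i, j) \<notin> ?C" for i j
  proof -
    have "i \<in> verts (tight_digraph A x lam)" by (simp add: tight_digraph_def)
    then have "i \<in> R i" by (simp add: R_def)
    then have "R j \<subset> R i" using that C R_sub[of i j] by auto
    then show ?thesis by (simp add: h_def psubset_card_mono)
  qed
  have le: "A $ i $ j * x $ j \<le> lam * x $ i" and x0: "0 \<le> x $ i" and a0: "0 \<le> A $ i $ j" for i j
    using x A by (auto simp: V_iff nonneg_mat_def)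
  \<comment> \<open>A factor \<open>t > 1\<close> close enough to 1 preserves the finitely many
    strict inequalities, even when raised to the largest possible exponent
    \<open>?n\<close>.\<close>
  have "\<forall>\<^sub>F t in at_right 1. \<forall>i j. A $ i $ j * x $ j < lam * x $ i \<longrightarrow>
      A $ i $ j * x $ j * t ^ ?n < lam * x $ i"
  proof (intro eventually_all_finite)
    fix i j
    have "((\<lambda>t. A $ i $ j * x $ j * t ^ ?n) \<longlongrightarrow> A $ i $ j * x $ j * 1 ^ ?n) (at_right 1)"
      by (intro tendsto_intros)
    then show "\<forall>\<^sub>F t in at_right 1. A $ i $ j * x $ j < lam * x $ i \<longrightarrow>
        A $ i $ j * x $ j * t ^ ?n < lam * x $ i"
      by (cases "A $ i $ j * x $ j < lam * x $ i") (auto dest: order_tendstoD(2))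
  qed
  moreover have "\<forall>\<^sub>F t in at_right (1::real). 1 < t" by (simp add: eventually_at_right_less)
  ultimately have "\<forall>\<^sub>F t in at_right 1. 1 < t \<and> (\<forall>i j. A $ i $ j * x $ j < lam * x $ i \<longrightarrow>
      A $ i $ j * x $ j * t ^ ?n < lam * x $ i)"
    by (rule eventually_conj[rotated])
  then obtain t :: real where t: "1 < t"
    and t_less: "\<And>i j. A $ i $ j * x $ j < lam * x $ i \<Longrightarrow> A $ i $ j * x $ j * t ^ ?n < lam * x $ i"
    using eventually_happens'[OF trivial_limit_at_right_real] by blast
  \<comment> \<open>Scaling by powers of \<open>t\<close> keeps equality on critical arcs, where
    \<open>h\<close> is constant, and creates slack on the other tight arcs, where \<open>h\<close>
    drops.\<close>
  define b :: "real ^ 'n" where "b = (\<chi> i. x $ i * t ^ h i)"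
  have b_nth: "b $ i = x $ i * t ^ h i" for i by (simp add: b_def)
  have tp: "0 < t ^ k" "1 \<le> t ^ k" for k using t by (simp_all add: one_le_power)
  have "0 < b $ i \<longleftrightarrow> 0 < x $ i" for i
    using mult_less_cancel_right_pos[OF tp(1)[of "h i"], of 0] by (simp add: b_nth)
  then have supp: "supp b = supp x" by (simp add: supp_def)
  have eq: "A $ i $ j * b $ j = lam * b $ i" if "(i, j) \<in> ?C" for i j
    using that h_eq[OF that] C by (auto simp: tight_def b_nth)
  have less: "A $ i $ j * b $ j < lam * b $ i" if i: "0 < x $ i" and nC: "(i, j) \<notin> ?C" for i j
  proof (cases "(i, j) \<in> ?T")
    case True
    then have "lam * x $ i * t ^ h j < lam * x $ i * t ^ h i"
      using h_less nC t lam i by (intro mult_strict_left_mono power_strict_increasing) auto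
    moreover have "A $ i $ j * x $ j = lam * x $ i" using True by (simp add: tight_def)
    ultimately show ?thesis by (simp add: b_nth mult.assoc[symmetric])
  next
    case False
    \<comment> \<open>For an arc that was not tight, \<open>h\<close> may increase, but the choice
      of \<open>t\<close> absorbs this.\<close>
    then have "A $ i $ j * x $ j < lam * x $ i" using i le[of i j] by (auto simp: tight_def)
    then have "A $ i $ j * x $ j * t ^ ?n < lam * x $ i" by (rule t_less)
    moreover have "A $ i $ j * x $ j * t ^ h j \<le> A $ i $ j * x $ j * t ^ ?n"
      using t h_le x0 a0 by (intro mult_left_mono power_increasing mult_nonneg_nonneg) auto
    moreover have "lam * x $ i * 1 \<le> lam * x $ i * t ^ h i"
      using lam i tp by (intro mult_left_mono) auto
    ultimately show ?thesis by (simp add: b_nth mult_ac)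
  qed
  have zero: "A $ i $ j * b $ j = lam * b $ i" if "\<not> 0 < x $ i" for i j
  proof -
    have xi: "x $ i = 0" using that x0[of i] by simp
    then have "A $ i $ j * x $ j = 0" using le[of i j] a0[of i j] x0[of j]
      by (metis antisym mult_nonneg_nonneg mult_zero_right)
    then show ?thesis using xi by (auto simp: b_nth)
  qed
  have "b \<in> V A lam" unfolding V_iff
  proof (intro conjI allI)
    fix i j
    show "0 \<le> b $ i" using x0[of i] tp[of "h i"] by (simp add: b_nth)
    show "A $ i $ j * b $ j \<le> lam * b $ i"
      using eq less zero by (metis less_eq_real_def order_refl)
    show "\<exists>j. A $ i $ j * b $ j = lam * b $ i"
    proof (cases "0 < x $ i")
      case True
      \<comment> \<open>Condition (iii) leaves each row of the support a critical arc, so its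
        maximum is still attained after scaling.\<close>
      then have "i \<in> fst ` ?C" using nodes Gc_tight(2)[OF A x lam] by (auto simp: Nc_def supp_def)
      then show ?thesis using eq by fastforce
    qed (use zero in blast)
  qed
  moreover have "tight A b lam = ?C"
  proof -
    have "0 < b $ i \<longleftrightarrow> 0 < x $ i" for i using supp by (auto simp: supp_def)
    moreover have "0 < x $ i" if "(i, j) \<in> ?C" for i j using that C by (simp add: tight_def)
    ultimately show ?thesis using eq less by (fastforce simp: tight_def)
  qed
  ultimately show thesis using that supp by blast
qed

theorem theorem3p10:
  fixes A :: "real ^ 'n ^ 'n" and lam :: real
  assumes "nonneg_mat A" and "max_eigenvalue A lam"
  shows "(\<forall>x\<in>V A lam. Gc A x lam = restrict_nodes (Gc_full A lam) (supp x)) \<and>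
    ((\<exists>b. simple_image_eigenvector A lam b) \<longleftrightarrow>
     (\<exists>N'. N' \<noteq> {} \<and>
       (\<exists>x\<in>V A lam. supp x = N' \<and>
         (\<forall>i. i \<notin> N' \<longrightarrow> gamma_star A x i = 0) \<and>
         N' = Nc A x lam \<and>
         (\<forall>H\<in>pre_digraph.sccs (Gc A x lam). is_cycle_graph H))))"
    (is "?restrict \<and> (?simple \<longleftrightarrow> ?N')")
proof (intro conjI iffI)
  note A = assms(1)
  have lam0: "0 \<le> lam" using assms(2) by (simp add: max_eigenvalue_def)
  have supp_ne: "x \<noteq> 0 \<longleftrightarrow> supp x \<noteq> {}" if "x \<in> V A lam" for x
    using that by (auto simp: supp_def V_iff vec_eq_iff less_le)
  obtain z where z: "max_support A lam z" using max_support_exists assms by blast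
  show ?restrict
    using Gc_eq_restrict_nodes[OF A] z Gc_full_eq[OF z] by (simp add: max_support_def)
  show ?N' if s: ?simple
  proof -
    obtain b where s: "simple_image_eigenvector A lam b" using s by blast
    have b: "b \<in> V A lam" "b \<noteq> 0" using s by (auto simp: simple_image_eigenvector_def)
    have lam: "0 < lam" using simple_image_eigenvector_imp_pos[OF A lam0 s] .
    have *: "\<forall>i. i \<notin> supp b \<longrightarrow> gamma_star A b i = 0" "inj_on fst (tight A b lam)"
      "snd ` tight A b lam = supp b"
      using simple_image_eigenvector_iff[OF A b lam] s by auto
    have arcs: "arcs (Gc A b lam) = tight A b lam" using arcs_Gc_eq_tight[OF A b(1) lam] * by simp
    then have "supp b = Nc A b lam"
      using Gc_tight(2)[OF A b(1) lam] fst_tight[OF b(1)] by (simp add: Nc_def)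
    then show ?thesis
      using b * supp_ne arcs sccs_cycle_iff[OF A b(1) lam]
      by (intro exI[of _ "supp b"] conjI bexI[of _ b]) auto
  qed
  show ?simple if N': ?N'
  proof -
    obtain x where x: "x \<in> V A lam" "supp x \<noteq> {}"
      and g: "\<forall>i. i \<notin> supp x \<longrightarrow> gamma_star A x i = 0" and nodes: "supp x = Nc A x lam"
      and sccs: "\<forall>H\<in>pre_digraph.sccs (Gc A x lam). is_cycle_graph H"
      using N' by blast
    have "Nc A x lam \<noteq> {}" using x nodes by simp
    \<comment> \<open>The support is nonempty, so (iii) yields a critical cycle.\<close>
    then have lam: "0 < lam" using critical_cycle_pos by (fastforce simp: Nc_def Gc_def)
    obtain b where b: "b \<in> V A lam" "supp b = supp x" "tight A b lam = arcs (Gc A x lam)"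
      using strict_visualization[OF A x(1) lam nodes] .
    have "b \<noteq> 0" using b x supp_ne by blast
    have nn: "nonneg_vec x" "nonneg_vec b" using x b by (simp_all add: V_def)
    \<comment> \<open>Whether \<open>gamma_star\<close> is 0 depends on the vector only through its
      zero entries, so (ii) passes from \<open>x\<close> to \<open>b\<close>.\<close>
    have "b $ k = 0 \<longleftrightarrow> x $ k = 0" for k
      using nn b(2) by (force simp: supp_def nonneg_vec_def set_eq_iff less_le)
    then have "\<forall>i. i \<notin> supp b \<longrightarrow> gamma_star A b i = 0"
      using g b(2) gamma_star_eq_0_iff(1)[OF A] nn by simp
    moreover have "inj_on fst (tight A b lam)" using sccs sccs_cycle_iff[OF A x(1) lam] b(3) by simp
    moreover have "snd ` tight A b lam = supp b"
      using b nodes Gc_tight(3)[OF A x(1) lam] by (simp add: Nc_def)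
    ultimately show ?thesis using simple_image_eigenvector_iff[OF A b(1) \<open>b \<noteq> 0\<close> lam] by blast
  qed
qed

end
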